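(* Let $\tau>0$, let $\mathcal{G}=(\mathcal{V},\mathcal{E})$ be a connected simple undirected graph with $n>0$ nodes $\mathcal{V}=\{1,\dots,n\}$ and diameter $\Delta>0$, and let $\beta_g\ge\alpha_g>0$. Then there exist $n$ functions $f_i:\ell_2\to\mathbb{R}$, $i=1,\dots,n$ (each strongly convex and smooth), such that $\bar f=\frac1n\sum_{i=1}^n f_i$ is $\alpha_g$-strongly convex and $\beta_g$-smooth and, for every $t\ge 0$ and every black-box procedure (run on $f_1,\dots,f_n$ over $\mathcal{G}$ with communication time $\tau$), one has for all $i\in\{1,\dots,n\}$ $$\bar f(\theta_{i,t})-\bar f(\theta^* )\ \ge\ \frac{\alpha_g}{2}\left(1-\frac{4}{\sqrt{\kappa_g}}\right)_+^{1+\frac{t}{1+\Delta\tau}}\|\theta_{i,0}-\theta^*\|^2,$$ where $\kappa_g=\beta_g/\alpha_g$, $\theta^*$ is the minimizer of $\bar f$, and $(x)_+=\max\{x,0\}$.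
   Context: $\ell_2=\{\theta=(\theta_k)_{k\in\mathbb{N}}:\sum_k\theta_k^2<+\infty\}$ with its usual norm. $f^*$ applied to a function denotes its Fenchel conjugate. A function is $\beta$-smooth if it is differentiable with $\beta$-Lipschitz gradient. Black-box procedure: a distributed algorithm run on the nodes of $\mathcal{G}$, where node $i$ has access to $f_i$ only, a local computation takes time $1$, and a communication between neighbors takes time $\tau$; computations and communications may be done in parallel and asynchronously. It satisfies the following constraints. (1) Local memory: at each time $t\ge0$ node $i$ has a finite internal memory $\mathcal{M}_{i,t}\subset\ell_2$, with $\mathcal{M}_{i,0}=\{0\}$ and $\mathcal{M}_{i,t}\subset\mathcal{M}^{comp}_{i,t}\cup\mathcal{M}^{comm}_{i,t}$ for $t>0$. (2) Local computation: $\mathcal{M}^{comp}_{i,t}=\mathrm{Span}(\{\theta,\nabla f_i(\theta),\nabla f_i^*(\theta):\theta\in\mathcal{M}_{i,t-1}\})$. (3) Local communication: $\mathcal{M}^{comm}_{i,t}=\mathrm{Span}\big(\bigcup_{(i,j)\in\mathcal{E}}\mathcal{M}_{j,t-\tau}\big)$. (4) Output value: at each time $t$ node $i$ specifies a vector $\theta_{i,t}\in\mathcal{M}_{i,t}$ as its local output. Convention: memories at negative times are empty, and $\mathrm{Span}(\emptyset)=\{0\}$. *)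

theory Defs
  imports
    "HOL-Analysis.Analysis"
    "Graph_Theory.Pair_Digraph"
    "Graph_Theory.Digraph_Component"
    "Graph_Theory.Shortest_Path"
begin

section \<open>The real sequence space \<open>\<ell>\<^sub>2\<close>\<close>

typedef ell2 = "{x :: nat \<Rightarrow> real. summable (\<lambda>k. (x k)\<^sup>2)}"
  morphisms ell2_nth Abs_ell2
  by (rule exI[of _ "\<lambda>_. 0"]) simp

setup_lifting type_definition_ell2

lemma summable_mult_square_summable:
  fixes x y :: "nat \<Rightarrow> real"
  assumes "summable (\<lambda>k. (x k)\<^sup>2)" "summable (\<lambda>k. (y k)\<^sup>2)"
  shows "summable (\<lambda>k. x k * y k)"
proof (rule summable_comparison_test')
  show "summable (\<lambda>k. (x k)\<^sup>2 + (y k)\<^sup>2)"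
    using assms by (rule summable_add)
  fix k :: nat
  have "0 \<le> (\<bar>x k\<bar> - \<bar>y k\<bar>)\<^sup>2"
    by simp
  then have "2 * (\<bar>x k\<bar> * \<bar>y k\<bar>) \<le> (x k)\<^sup>2 + (y k)\<^sup>2"
    by (simp add: power2_diff)
  moreover have "0 \<le> \<bar>x k\<bar> * \<bar>y k\<bar>"
    by simp
  ultimately show "norm (x k * y k) \<le> (x k)\<^sup>2 + (y k)\<^sup>2"
    unfolding real_norm_def abs_mult by linarith
qed

lemma summable_add_square_summable:
  fixes x y :: "nat \<Rightarrow> real"
  assumes "summable (\<lambda>k. (x k)\<^sup>2)" "summable (\<lambda>k. (y k)\<^sup>2)"
  shows "summable (\<lambda>k. (x k + y k)\<^sup>2)"
proof -
  have "summable (\<lambda>k. (x k)\<^sup>2 + (y k)\<^sup>2 + 2 * (x k * y k))"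
    by (intro summable_add summable_mult summable_mult_square_summable assms)
  then show ?thesis
    by (simp add: power2_sum mult.assoc)
qed

instantiation ell2 :: real_inner
begin

lift_definition zero_ell2 :: ell2 is "\<lambda>_. 0"
  by simp

lift_definition plus_ell2 :: "ell2 \<Rightarrow> ell2 \<Rightarrow> ell2" is "\<lambda>x y k. x k + y k"
  by (rule summable_add_square_summable)

lift_definition uminus_ell2 :: "ell2 \<Rightarrow> ell2" is "\<lambda>x k. - x k"
  by simp

lift_definition minus_ell2 :: "ell2 \<Rightarrow> ell2 \<Rightarrow> ell2" is "\<lambda>x y k. x k - y k"
  using summable_add_square_summable[of _ "\<lambda>k. - _ k"] by simp

lift_definition scaleR_ell2 :: "real \<Rightarrow> ell2 \<Rightarrow> ell2" is "\<lambda>c x k. c * x k"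
  by (simp add: power_mult_distrib summable_mult)

lift_definition inner_ell2 :: "ell2 \<Rightarrow> ell2 \<Rightarrow> real" is "\<lambda>x y. \<Sum>k. x k * y k" .

definition norm_ell2 :: "ell2 \<Rightarrow> real"
  where "norm_ell2 x = sqrt (inner x x)"

definition dist_ell2 :: "ell2 \<Rightarrow> ell2 \<Rightarrow> real"
  where "dist_ell2 x y = norm (x - y)"

definition sgn_ell2 :: "ell2 \<Rightarrow> ell2"
  where "sgn_ell2 x = inverse (norm x) *\<^sub>R x"

definition uniformity_ell2 :: "(ell2 \<times> ell2) filter"
  where "uniformity_ell2 = (INF e\<in>{0<..}. principal {(x, y). dist x y < e})"

definition open_ell2 :: "ell2 set \<Rightarrow> bool"
  where "open_ell2 U \<longleftrightarrow> (\<forall>x\<in>U. \<forall>\<^sub>F (x', y) in uniformity. x' = x \<longrightarrow> y \<in> U)"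

instance
proof
  fix x y z :: ell2 and a b :: real
  show "x + y + z = x + (y + z)" by transfer (simp add: add.assoc)
  show "x + y = y + x" by transfer (simp add: add.commute)
  show "0 + x = x" by transfer simp
  show "- x + x = 0" by transfer simp
  show "x - y = x + - y" by transfer simp
  show "a *\<^sub>R (x + y) = a *\<^sub>R x + a *\<^sub>R y" by transfer (simp add: algebra_simps)
  show "(a + b) *\<^sub>R x = a *\<^sub>R x + b *\<^sub>R x" by transfer (simp add: algebra_simps)
  show "a *\<^sub>R b *\<^sub>R x = (a * b) *\<^sub>R x" by transfer (simp add: algebra_simps)
  show "1 *\<^sub>R x = x" by transfer simp
  show "dist x y = norm (x - y)" by (fact dist_ell2_def)
  show "sgn x = inverse (norm x) *\<^sub>R x" by (fact sgn_ell2_def)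
  show "(uniformity :: (ell2 \<times> ell2) filter) = (INF e\<in>{0<..}. principal {(x, y). dist x y < e})"
    by (fact uniformity_ell2_def)
  show "open U \<longleftrightarrow> (\<forall>x\<in>U. \<forall>\<^sub>F (x', y) in uniformity. x' = x \<longrightarrow> y \<in> U)" for U :: "ell2 set"
    by (fact open_ell2_def)
  show "inner x y = inner y x" by transfer (simp add: mult.commute)
  show "inner (x + y) z = inner x z + inner y z"
    by transfer (simp add: distrib_right suminf_add summable_mult_square_summable)
  show "inner (a *\<^sub>R x) y = a * inner x y"
    by transfer (simp add: mult.assoc suminf_mult summable_mult_square_summable)
  show "0 \<le> inner x x"
    by transfer (simp add: suminf_nonneg flip: power2_eq_square)
  show "inner x x = 0 \<longleftrightarrow> x = 0"
    by transfer (simp add: suminf_eq_zero_iff fun_eq_iff flip: power2_eq_square)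
  show "norm x = sqrt (inner x x)" by (fact norm_ell2_def)
qed

end

section \<open>Convex analysis\<close>

definition gradient :: "('a::real_inner \<Rightarrow> real) \<Rightarrow> 'a \<Rightarrow> 'a"
  where "gradient f x = (THE g. GDERIV f x :> g)"

definition smooth :: "real \<Rightarrow> ('a::real_inner \<Rightarrow> real) \<Rightarrow> bool"
  where "smooth \<beta> f \<longleftrightarrow> (\<forall>x. \<exists>g. GDERIV f x :> g) \<and> \<beta>-lipschitz_on UNIV (gradient f)"

definition strongly_convex :: "real \<Rightarrow> ('a::real_inner \<Rightarrow> real) \<Rightarrow> bool"
  where "strongly_convex \<alpha> f \<longleftrightarrow> convex_on UNIV (\<lambda>x. f x - \<alpha> / 2 * (norm x)\<^sup>2)"

text \<open>
  The supremum is taken in the reals, so this is the Fenchel conjugate only where the conjugate is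
  finite. For a smooth and strongly convex function on \<open>\<ell>\<^sub>2\<close> that is everywhere.
\<close>
definition fenchel_conjugate :: "('a::real_inner \<Rightarrow> real) \<Rightarrow> 'a \<Rightarrow> real"
  where "fenchel_conjugate f y = (SUP x. inner y x - f x)"

definition average :: "nat \<Rightarrow> (nat \<Rightarrow> 'a \<Rightarrow> real) \<Rightarrow> 'a \<Rightarrow> real"
  where "average n f \<theta> = 1 / real n * (\<Sum>i=1..n. f i \<theta>)"

section \<open>Diameter of a graph\<close>

text \<open>With unit weights, \<open>\<mu>\<close> is the length of a shortest walk.\<close>
definition graph_diameter :: "'a pair_pre_digraph \<Rightarrow> ereal"
  where "graph_diameter G =
    (SUP u\<in>pverts G. SUP v\<in>pverts G. wf_digraph.\<mu> (with_proj G) (\<lambda>_. 1) u v)"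

section \<open>Black-box procedures\<close>

text \<open>
  \<open>M i t\<close> is the memory of node \<open>i\<close> at the real time \<open>t\<close>, and \<open>out i t\<close> its output.
\<close>

definition comp_memory ::
    "('a::real_inner \<Rightarrow> real) \<Rightarrow> (real \<Rightarrow> 'a set) \<Rightarrow> real \<Rightarrow> 'a set"
  where "comp_memory f M t =
    span (\<Union>\<theta>\<in>M (t - 1). {\<theta>, gradient f \<theta>, gradient (fenchel_conjugate f) \<theta>})"

definition comm_memory ::
    "'v pair_pre_digraph \<Rightarrow> real \<Rightarrow> ('v \<Rightarrow> real \<Rightarrow> 'a::real_inner set) \<Rightarrow> 'v \<Rightarrow> real \<Rightarrow> 'a set"
  where "comm_memory G \<tau> M i t = span (\<Union>j\<in>{j. (i, j) \<in> parcs G}. M j (t - \<tau>))"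

definition black_box_procedure ::
    "'v pair_pre_digraph \<Rightarrow> real \<Rightarrow> ('v \<Rightarrow> ell2 \<Rightarrow> real) \<Rightarrow>
     ('v \<Rightarrow> real \<Rightarrow> ell2 set) \<Rightarrow> ('v \<Rightarrow> real \<Rightarrow> ell2) \<Rightarrow> bool"
  where "black_box_procedure G \<tau> f M out \<longleftrightarrow>
    (\<forall>i\<in>pverts G.
      (\<forall>t<0. M i t = {}) \<and>
      M i 0 = {0} \<and>
      (\<forall>t\<ge>0. finite (M i t)) \<and>
      (\<forall>t>0. M i t \<subseteq> comp_memory (f i) (M i) t \<union> comm_memory G \<tau> M i t) \<and>
      (\<forall>t\<ge>0. out i t \<in> M i t))"

end

theory Submission
  imports Defs
begin

text \<open>
  A quadratic function on \<open>\<ell>\<^sub>2\<close> that is hard for every first-order method is split between two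
  nodes \<open>u\<close> and \<open>v\<close> at distance \<open>\<Delta>\<close>. Up to a linear term it is
  \<open>\<alpha> / 2 * \<Sum>\<^sub>k (x\<^sub>k)\<^sup>2 + (\<beta> - \<alpha>) / 8 * \<Sum>\<^sub>k (x\<^sub>k - x\<^sub>k\<^sub>+\<^sub>1)\<^sup>2\<close>, a chain of springs in which
  neighbouring coordinates are coupled. Node \<open>v\<close> holds the springs between \<open>2j\<close> and \<open>2j + 1\<close>, node \<open>u\<close> holds
  those between \<open>2j + 1\<close> and \<open>2j + 2\<close> together with the linear term, which is a multiple of the first
  coordinate. Each node holds a multiple of \<open>\<parallel>x\<parallel>\<^sup>2\<close>, and the nodes other than \<open>u\<close> and \<open>v\<close> hold no
  more than that.

  All memories start at \<open>0\<close>. If a vector has only its first \<open>m\<close> coordinates nonzero, then the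
  gradient and the gradient of the conjugate can make coordinate \<open>m\<close> nonzero only at \<open>u\<close> when \<open>m\<close> is
  even and only at \<open>v\<close> when \<open>m\<close> is odd, and they make at most that one coordinate nonzero. So each
  further coordinate costs one computation and one journey between \<open>u\<close> and \<open>v\<close>, that is time
  \<open>1 + \<Delta> * \<tau>\<close>, except that the first needs no journey. Hence at time \<open>t\<close> only the first \<open>m\<close>
  coordinates of any output can be nonzero, for some \<open>m \<le> 1 + t / (1 + \<Delta> * \<tau>)\<close>. This is
  \<open>memory_confined\<close>, which bounds the time along a potential that stands in for the distance.

  The linear term is scaled so that the minimiser is \<open>\<theta>\<^sub>k = q\<^sup>k\<close> with \<open>q = (\<surd>\<kappa> - 1) / (\<surd>\<kappa> + 1)\<close>
  (\<open>chain_geometric\<close>). A vector supported on \<open>m\<close> coordinates misses the tail of the minimiser, whose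
  squared norm is the fraction \<open>q\<^sup>2\<^sup>m\<close> of the whole (\<open>dist_geometric\<close>), and strong convexity turns
  this squared distance into a gap of the function values. Finally \<open>q\<^sup>2 \<ge> 1 - 4 / \<surd>\<kappa>\<close>
  (\<open>contraction_ratio\<close>).

  Everything about the functions is computed from one description: the permutation of coordinates
  that swaps the two ends of each spring held at a node is a linear isometric involution \<open>S\<close>, and the node's
  Hessian is \<open>\<alpha> + c * (1 - S)\<close>. As \<open>S\<^sup>2 = 1\<close>, its inverse is again a combination of \<open>1\<close> and \<open>S\<close>,
  which makes the conjugate explicit.
\<close>

section \<open>Quadratic functions\<close>

definition quadratic :: "('a::real_inner \<Rightarrow> 'a) \<Rightarrow> 'a \<Rightarrow> 'a \<Rightarrow> real"
  where "quadratic A b x = inner x (A x) / 2 - inner b x"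

locale self_adjoint = bounded_linear A for A :: "'a::real_inner \<Rightarrow> 'a" +
  assumes adjoint: "inner (A x) y = inner x (A y)"
begin

lemma quadratic_add:
  "quadratic A b (x + h) = quadratic A b x + inner h (A x - b) + inner h (A h) / 2"
proof -
  have "inner x (A h) = inner h (A x)"
    by (metis adjoint inner_commute)
  then show ?thesis
    by (simp add: quadratic_def add inner_add_left inner_add_right inner_diff_right
        inner_commute[of b h] add_divide_distrib)
qed

lemma GDERIV_quadratic: "GDERIV (quadratic A b) x :> A x - b"
proof -
  have "((\<lambda>x. inner x (A x) / 2 - inner b x) has_derivative
      (\<lambda>h. (inner x (A h) + inner h (A x)) / 2 - inner b h)) (at x)"
    by (auto intro!: derivative_eq_intros has_derivative)
  moreover have "(inner x (A h) + inner h (A x)) / 2 - inner b h = inner h (A x - b)" for h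
  proof -
    have "inner x (A h) = inner h (A x)" "inner b h = inner h b"
      by (metis adjoint inner_commute) (rule inner_commute)
    then show ?thesis by (simp add: inner_diff_right)
  qed
  ultimately show ?thesis
    by (simp add: gderiv_def quadratic_def[abs_def])
qed

end

lemma gradient_eq:
  assumes "GDERIV f x :> g"
  shows "gradient f x = g"
  unfolding gradient_def
proof (rule the_equality)
  fix g' assume "GDERIV f x :> g'"
  then have "(\<lambda>h. inner h g') = (\<lambda>h. inner h g)"
    using assms has_derivative_unique unfolding gderiv_def by blast
  then have "inner (g' - g) g' = inner (g' - g) g"
    by metis
  then have "inner (g' - g) (g' - g) = 0"
    by (simp add: inner_diff_right)
  then show "g' = g"
    by simp
qed fact

context self_adjoint begin

lemma gradient_quadratic: "gradient (quadratic A b) x = A x - b"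
  by (rule gradient_eq[OF GDERIV_quadratic])

lemma smooth_quadratic:
  assumes "\<And>x. norm (A x) \<le> \<beta> * norm x" "\<beta> \<ge> 0"
  shows "smooth \<beta> (quadratic A b)"
  unfolding smooth_def
proof (intro conjI allI lipschitz_onI)
  show "\<exists>g. GDERIV (quadratic A b) x :> g" for x
    using GDERIV_quadratic by blast
  show "dist (gradient (quadratic A b) x) (gradient (quadratic A b) y) \<le> \<beta> * dist x y" for x y
    using assms(1)[of "x - y"] by (simp add: gradient_quadratic dist_norm diff)
qed fact

lemma strongly_convex_quadratic:
  assumes "\<And>x. inner x (A x) \<ge> \<alpha> * (norm x)\<^sup>2"
  shows "strongly_convex \<alpha> (quadratic A b)"
  unfolding strongly_convex_def
proof (rule convex_onI)
  fix s :: real and x y :: 'a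
  assume s: "0 < s" "s < 1"
  let ?f = "\<lambda>x. quadratic A b x - \<alpha> / 2 * (norm x)\<^sup>2"
  have "(1 - s) * ?f x + s * ?f y - ?f ((1 - s) *\<^sub>R x + s *\<^sub>R y)
      = s * (1 - s) / 2 * (inner (x - y) (A (x - y)) - \<alpha> * (norm (x - y))\<^sup>2)"
  proof -
    have "inner x (A y) = inner y (A x)" "inner x y = inner y x"
      by (metis adjoint inner_commute) (rule inner_commute)
    then show ?thesis
      by (simp add: quadratic_def add diff scaleR power2_norm_eq_inner inner_add_left inner_add_right
          inner_diff_left inner_diff_right field_simps)
  qed
  also have "\<dots> \<ge> 0"
    using assms[of "x - y"] s by (intro mult_nonneg_nonneg) auto
  finally show "?f ((1 - s) *\<^sub>R x + s *\<^sub>R y) \<le> (1 - s) * ?f x + s * ?f y"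
    by simp
qed simp

lemma quadratic_gap:
  assumes "\<And>x. inner x (A x) \<ge> \<alpha> * (norm x)\<^sup>2" "A z = b"
  shows "quadratic A b x - quadratic A b z \<ge> \<alpha> / 2 * (norm (x - z))\<^sup>2"
  using quadratic_add[of b z "x - z"] assms(1)[of "x - z"] assms(2) by simp

lemma is_arg_min_quadratic:
  assumes "\<And>x. inner x (A x) \<ge> \<alpha> * (norm x)\<^sup>2" "\<alpha> > 0" "A z = b"
  shows "is_arg_min (quadratic A b) (\<lambda>_. True) x \<longleftrightarrow> x = z"
proof -
  have gap: "quadratic A b z + \<alpha> / 2 * (norm (y - z))\<^sup>2 \<le> quadratic A b y" for y
    using quadratic_gap[OF assms(1,3), of y] by simp
  then have le: "quadratic A b z \<le> quadratic A b y" for y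
    using order_trans[OF _ gap[of y], of "quadratic A b z"] assms(2) by simp
  have less: "quadratic A b z < quadratic A b y" if "y \<noteq> z" for y
  proof -
    have "\<alpha> / 2 * (norm (y - z))\<^sup>2 > 0"
      using that assms(2) by simp
    then show ?thesis using gap[of y] by simp
  qed
  show ?thesis
    using le less by (auto simp: is_arg_min_linorder) (metis linorder_not_le)
qed

text \<open>
  Completing the square around \<open>z = B (y + b)\<close>, where \<open>x \<mapsto> inner y x - quadratic A b x\<close> is stationary:
  the supremum is a maximum, so it is the true conjugate value.
\<close>
lemma fenchel_conjugate_quadratic:
  assumes "\<And>x. inner x (A x) \<ge> 0" and inv: "\<And>y. A (B y) = y"
  shows "fenchel_conjugate (quadratic A b) y = inner (y + b) (B (y + b)) / 2"
proof -
  define z where "z = B (y + b)"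
  have Az: "A z = y + b"
    by (simp add: z_def inv)
  have val: "inner y x - quadratic A b x = inner (y + b) z / 2 - inner (x - z) (A (x - z)) / 2" for x
  proof -
    have "inner z (A x) = inner x (y + b)" "inner z (y + b) = inner (y + b) z"
      "inner x y = inner y x" "inner x b = inner b x"
      by (metis Az adjoint inner_commute) (rule inner_commute)+
    then show ?thesis
      by (simp add: quadratic_def diff Az inner_add_left inner_add_right
          inner_diff_left inner_diff_right field_simps)
  qed
  have "(SUP x. inner y x - quadratic A b x) = inner (y + b) z / 2"
  proof (rule cSup_eq_maximum)
    have "inner y z - quadratic A b z = inner (y + b) z / 2"
      using val[of z] by simp
    then show "inner (y + b) z / 2 \<in> range (\<lambda>x. inner y x - quadratic A b x)"
      by (intro image_eqI[of _ _ z]) simp_all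
    show "v \<le> inner (y + b) z / 2" if v: "v \<in> range (\<lambda>x. inner y x - quadratic A b x)" for v
    proof -
      obtain x where "v = inner y x - quadratic A b x"
        using v by auto
      then show ?thesis
        using val[of x] assms(1)[of "x - z"] by linarith
    qed
  qed
  then show ?thesis
    by (simp add: fenchel_conjugate_def z_def)
qed

end

lemma gradient_fenchel_conjugate_quadratic:
  assumes "self_adjoint A" "self_adjoint B" and "\<And>x. inner x (A x) \<ge> 0" and "\<And>y. A (B y) = y"
  shows "gradient (fenchel_conjugate (quadratic A b)) y = B (y + b)"
proof (rule gradient_eq)
  interpret A: self_adjoint A by fact
  interpret B: self_adjoint B by fact
  have "inner (y + b) (B (y + b)) / 2 = quadratic B (- B b) y + quadratic B 0 b" for y
  proof -
    have "inner b (B y) = inner y (B b)" "inner (B b) y = inner y (B b)"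
      by (metis B.adjoint inner_commute) (rule inner_commute)
    then show ?thesis
      by (simp add: quadratic_def B.add inner_add_left inner_add_right add_divide_distrib)
  qed
  then have "fenchel_conjugate (quadratic A b)
      = (\<lambda>y. quadratic B (- B b) y + quadratic B 0 b)"
    by (simp add: fun_eq_iff A.fenchel_conjugate_quadratic[OF assms(3,4)])
  moreover have "GDERIV (\<lambda>y. quadratic B (- B b) y + quadratic B 0 b) y :> B (y + b)"
    using GDERIV_add[OF B.GDERIV_quadratic[of "- B b" y] GDERIV_const[of "quadratic B 0 b" y]]
    by (simp add: B.add)
  ultimately show "GDERIV (fenchel_conjugate (quadratic A b)) y :> B (y + b)"
    by simp
qed

lemma average_quadratic:
  "average n (\<lambda>i. quadratic (A i) (b i))
    = quadratic (\<lambda>x. (1 / real n) *\<^sub>R (\<Sum>i=1..n. A i x)) ((1 / real n) *\<^sub>R (\<Sum>i=1..n. b i))"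
proof
  fix x
  have "(\<Sum>i=1..n. inner x (A i x) / 2) = inner x (\<Sum>i=1..n. A i x) / 2"
    by (simp only: inner_sum_right sum_divide_distrib)
  then have "(\<Sum>i=1..n. quadratic (A i) (b i) x)
      = inner x (\<Sum>i=1..n. A i x) / 2 - inner (\<Sum>i=1..n. b i) x"
    by (simp only: quadratic_def sum_subtractf inner_sum_left)
  then show "average n (\<lambda>i. quadratic (A i) (b i)) x
      = quadratic (\<lambda>x. (1 / real n) *\<^sub>R (\<Sum>i=1..n. A i x)) ((1 / real n) *\<^sub>R (\<Sum>i=1..n. b i)) x"
    unfolding average_def quadratic_def inner_scaleR_left inner_scaleR_right
    by (simp only: right_diff_distrib times_divide_eq_right)
qed

section \<open>Reflections\<close>

text \<open>
  These are the linear isometries that are their own inverse, hence self-adjoint with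
  eigenvalues in \<open>{-1, 1}\<close>.
\<close>
locale reflection = bounded_linear S for S :: "'a::real_inner \<Rightarrow> 'a" +
  assumes involution: "S (S x) = x"
    and isometry: "norm (S x) = norm x"
begin

lemma inner_reflection: "inner (S x) (S y) = inner x y"
  using isometry[of "x + y"] isometry[of "x - y"]
  by (simp add: dot_norm[of x y] dot_norm[of "S x"] isometry add)

lemma adjoint: "inner (S x) y = inner x (S y)"
  using inner_reflection[of x "S y"] by (simp add: involution)

lemma inner_le: "inner x (S x) \<le> (norm x)\<^sup>2"
  using norm_cauchy_schwarz[of x "S x"] by (simp add: isometry power2_eq_square)

end

text \<open>
  The Hessian of \<open>\<alpha> / 2 * \<parallel>x\<parallel>\<^sup>2 + c / 4 * \<parallel>x - S x\<parallel>\<^sup>2\<close> for a reflection \<open>S\<close>.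
\<close>
definition coupling :: "real \<Rightarrow> real \<Rightarrow> ('a::real_inner \<Rightarrow> 'a) \<Rightarrow> 'a \<Rightarrow> 'a"
  where "coupling \<alpha> c S x = \<alpha> *\<^sub>R x + c *\<^sub>R (x - S x)"

definition coupling_inverse :: "real \<Rightarrow> real \<Rightarrow> ('a::real_inner \<Rightarrow> 'a) \<Rightarrow> 'a \<Rightarrow> 'a"
  where "coupling_inverse \<alpha> c S y = (1 / (\<alpha> * (\<alpha> + 2 * c))) *\<^sub>R ((\<alpha> + c) *\<^sub>R y + c *\<^sub>R S y)"

context reflection begin

lemma self_adjoint_coupling: "self_adjoint (coupling \<alpha> c S)"
proof
  show "\<exists>K. \<forall>x. norm (coupling \<alpha> c S x) \<le> norm x * K"
    unfolding coupling_def
    by (rule bounded_linear.bounded) (intro bounded_linear_intros bounded_linear_axioms)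
qed (simp_all add: coupling_def add scaleR adjoint algebra_simps)

lemma self_adjoint_coupling_inverse: "self_adjoint (coupling_inverse \<alpha> c S)"
proof
  show "\<exists>K. \<forall>x. norm (coupling_inverse \<alpha> c S x) \<le> norm x * K"
    unfolding coupling_inverse_def
    by (rule bounded_linear.bounded) (intro bounded_linear_intros bounded_linear_axioms)
qed (simp_all add: coupling_inverse_def add scaleR adjoint algebra_simps)

text \<open>
  From \<open>S\<^sup>2 = 1\<close> one gets \<open>(\<alpha> + c - c S) (\<alpha> + c + c S) = (\<alpha> + c)\<^sup>2 - c\<^sup>2 = \<alpha> (\<alpha> + 2 c)\<close>.
\<close>
lemma coupling_inverse:
  assumes "\<alpha> > 0" "c \<ge> 0"
  shows "coupling \<alpha> c S (coupling_inverse \<alpha> c S y) = y"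
proof -
  interpret C: self_adjoint "coupling \<alpha> c S"
    by (rule self_adjoint_coupling)
  let ?d = "\<alpha> * (\<alpha> + 2 * c)"
  have "coupling \<alpha> c S ((\<alpha> + c) *\<^sub>R y + c *\<^sub>R S y) = ?d *\<^sub>R y"
    by (simp add: coupling_def add diff scaleR involution algebra_simps)
      (simp flip: scaleR_add_left)
  moreover have "?d \<noteq> 0"
    using assms by simp
  ultimately show ?thesis
    by (simp add: coupling_inverse_def C.scaleR)
qed

lemma inner_coupling:
  assumes "c \<ge> 0"
  shows "inner x (coupling \<alpha> c S x) \<ge> \<alpha> * (norm x)\<^sup>2"
  using mult_left_mono[OF inner_le[of x] assms]
  by (simp add: coupling_def inner_add_right inner_diff_right power2_norm_eq_inner algebra_simps)

lemma norm_coupling: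
  assumes "\<alpha> \<ge> 0" "c \<ge> 0"
  shows "norm (coupling \<alpha> c S x) \<le> (\<alpha> + 2 * c) * norm x"
proof -
  have "norm (coupling \<alpha> c S x) \<le> \<alpha> * norm x + c * norm (x - S x)"
    using norm_triangle_ineq[of "\<alpha> *\<^sub>R x" "c *\<^sub>R (x - S x)"] assms by (simp add: coupling_def)
  also have "c * norm (x - S x) \<le> c * (2 * norm x)"
    using norm_triangle_ineq4[of x "S x"] assms by (intro mult_left_mono) (simp_all add: isometry)
  finally show ?thesis
    by (simp add: algebra_simps)
qed

text \<open>
  Both gradients are combinations of \<open>x\<close>, \<open>S x\<close>, \<open>b\<close> and \<open>S b\<close>. So a computation step leaves a
  subspace only through \<open>S\<close> or \<open>b\<close>, and the conjugate opens no other way out of it.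
\<close>
lemma gradients_coupling_in_subspace:
  assumes "\<alpha> > 0" "c \<ge> 0" "subspace W" "b \<in> W" "x \<in> W"
    and invariant: "\<And>x. c \<noteq> 0 \<Longrightarrow> x \<in> W \<Longrightarrow> S x \<in> W"
  shows "gradient (quadratic (coupling \<alpha> c S) b) x \<in> W"
    and "gradient (fenchel_conjugate (quadratic (coupling \<alpha> c S) b)) x \<in> W"
proof -
  interpret C: self_adjoint "coupling \<alpha> c S"
    by (rule self_adjoint_coupling)
  have S: "c *\<^sub>R S x \<in> W" if "x \<in> W" for x
    using that assms(3) invariant by (cases "c = 0") (auto intro: subspace_scale subspace_0)
  have "coupling \<alpha> c S x = (\<alpha> + c) *\<^sub>R x - c *\<^sub>R S x"
    by (simp add: coupling_def algebra_simps)
  then show "gradient (quadratic (coupling \<alpha> c S) b) x \<in> W"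
    using assms S by (simp add: C.gradient_quadratic subspace_diff subspace_scale)
  have "inner x (coupling \<alpha> c S x) \<ge> 0" for x
    using inner_coupling[OF assms(2), of \<alpha> x] assms(1)
    by (meson mult_nonneg_nonneg less_imp_le order_trans zero_le_power2)
  then have "gradient (fenchel_conjugate (quadratic (coupling \<alpha> c S) b)) x
      = coupling_inverse \<alpha> c S (x + b)"
    using assms(1,2) self_adjoint_coupling self_adjoint_coupling_inverse coupling_inverse
    by (intro gradient_fenchel_conjugate_quadratic) auto
  then show "gradient (fenchel_conjugate (quadratic (coupling \<alpha> c S) b)) x \<in> W"
    unfolding coupling_inverse_def using assms S[of "x + b"]
    by (simp add: subspace_add subspace_scale)
qed

end

section \<open>Permutations and supports in \<open>\<ell>\<^sub>2\<close>\<close>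

lemma summable_ell2: "summable (\<lambda>k. (ell2_nth x k)\<^sup>2)"
  using ell2_nth[of x] by simp

lemma ell2_eq_iff: "x = y \<longleftrightarrow> (\<forall>k. ell2_nth x k = ell2_nth y k)"
  by (simp add: ell2_nth_inject[symmetric] fun_eq_iff)

lemma norm_ell2_power2: "(norm x)\<^sup>2 = (\<Sum>k. (ell2_nth x k)\<^sup>2)"
  unfolding power2_norm_eq_inner inner_ell2.rep_eq by (simp add: power2_eq_square)

definition permute :: "(nat \<Rightarrow> nat) \<Rightarrow> ell2 \<Rightarrow> ell2"
  where "permute \<sigma> x = Abs_ell2 (\<lambda>k. ell2_nth x (\<sigma> k))"

lemma
  assumes "\<And>k. \<sigma> (\<sigma> k) = k"
  shows reflection_permute: "reflection (permute \<sigma>)"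
    and nth_permute: "ell2_nth (permute \<sigma> x) k = ell2_nth x (\<sigma> k)"
proof -
  have inj: "inj \<sigma>" and surj: "range \<sigma> = UNIV"
    using assms by (metis injI, metis surjI)
  note re = summable_ell2 inj zero_le_power2
  have nth: "ell2_nth (permute \<sigma> x) k = ell2_nth x (\<sigma> k)" for x k
    using summable_reindex[OF re, of x] by (simp add: permute_def Abs_ell2_inverse comp_def)
  have norm: "norm (permute \<sigma> x) = norm x" for x
  proof -
    have "(norm (permute \<sigma> x))\<^sup>2 = (norm x)\<^sup>2"
      using suminf_reindex[OF re, of x] surj by (simp add: norm_ell2_power2 nth comp_def)
    then show ?thesis by simp
  qed
  show "reflection (permute \<sigma>)"
  proof
    show "\<exists>K. \<forall>x. norm (permute \<sigma> x) \<le> norm x * K"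
      by (rule exI[of _ 1]) (simp add: norm)
  qed (simp_all add: ell2_eq_iff norm nth assms plus_ell2.rep_eq scaleR_ell2.rep_eq)
  show "ell2_nth (permute \<sigma> x) k = ell2_nth x (\<sigma> k)"
    by (rule nth)
qed

definition vanishing_from :: "nat \<Rightarrow> ell2 set"
  where "vanishing_from m = {x. \<forall>k\<ge>m. ell2_nth x k = 0}"

lemma subspace_vanishing_from: "subspace (vanishing_from m)"
  by (auto simp: subspace_def vanishing_from_def zero_ell2.rep_eq plus_ell2.rep_eq scaleR_ell2.rep_eq)

lift_definition first_unit :: ell2 is "\<lambda>k. if k = 0 then 1 else 0"
  by (rule summable_finite[of "{0}"]) auto

text \<open>
  For \<open>\<bar>q\<bar> \<ge> 1\<close> the powers of \<open>q\<close> are not square summable; the value \<open>0\<close> there makes the function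
  total.
\<close>
lift_definition geometric :: "real \<Rightarrow> ell2" is "\<lambda>q k. if \<bar>q\<bar> < 1 then q ^ k else 0"
proof -
  fix q :: real
  show "summable (\<lambda>k. (if \<bar>q\<bar> < 1 then q ^ k else 0)\<^sup>2)"
  proof (cases "\<bar>q\<bar> < 1")
    case True
    then have "summable (\<lambda>k. (q\<^sup>2) ^ k)"
      by (intro summable_geometric) (simp add: abs_square_less_1)
    then show ?thesis
      using True by (simp add: power2_eq_square power_mult_distrib)
  qed simp
qed

text \<open>
  Only the coordinates from \<open>m\<close> on are compared. There \<open>x\<close> vanishes and the geometric sequence is
  \<open>q ^ m\<close> times a copy of itself.
\<close>
lemma dist_geometric:
  assumes "x \<in> vanishing_from m" "\<bar>q\<bar> < 1"
  shows "(norm (x - geometric q))\<^sup>2 \<ge> (q\<^sup>2) ^ m * (norm (geometric q))\<^sup>2"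
proof -
  let ?d = "\<lambda>k. (ell2_nth (x - geometric q) k)\<^sup>2"
  have "(norm (x - geometric q))\<^sup>2 = (\<Sum>k. ?d (k + m)) + (\<Sum>k<m. ?d k)"
    unfolding norm_ell2_power2 by (rule suminf_split_initial_segment[OF summable_ell2])
  also have "\<dots> \<ge> (\<Sum>k. ?d (k + m))"
    by (simp add: sum_nonneg)
  also have "(\<lambda>k. ?d (k + m)) = (\<lambda>k. (q\<^sup>2) ^ m * (ell2_nth (geometric q) k)\<^sup>2)"
  proof
    fix k
    have "ell2_nth (x - geometric q) (k + m) = - (q ^ m * q ^ k)"
      using assms by (simp add: vanishing_from_def minus_ell2.rep_eq geometric.rep_eq power_add)
    then show "?d (k + m) = (q\<^sup>2) ^ m * (ell2_nth (geometric q) k)\<^sup>2"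
      using assms(2) by (simp add: geometric.rep_eq power2_eq_square power_mult_distrib)
  qed
  also have "(\<Sum>k. (q\<^sup>2) ^ m * (ell2_nth (geometric q) k)\<^sup>2) = (q\<^sup>2) ^ m * (norm (geometric q))\<^sup>2"
    by (simp add: norm_ell2_power2 suminf_mult summable_ell2)
  finally show ?thesis .
qed


section \<open>Propagation of memories through the network\<close>

text \<open>
  Here \<open>V m\<close> is an increasing chain of subspaces, and \<open>owner m\<close> is the only node whose computations can
  leave \<open>V m\<close>. Consecutive owners are far apart: \<open>p m\<close> is a potential that drops by at most \<open>1\<close> along
  an arc, is at most \<open>0\<close> at \<open>owner m\<close> and at least \<open>\<Delta>\<close> at the next owner. For
  \<open>m > 0\<close>, leaving \<open>V m\<close> requires that its owner already has a vector outside \<open>V (m - 1)\<close>. Such a vector was created at \<open>owner (m - 1)\<close> and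
  had to travel to \<open>owner m\<close>, which takes time \<open>\<Delta> * \<tau>\<close>, and the computation itself takes time \<open>1\<close>. The term
  \<open>\<tau> * p m i\<close> is the additional delay until the news reaches \<open>i\<close>.
\<close>
lemma memory_confined:
  fixes V :: "nat \<Rightarrow> ell2 set" and p :: "nat \<Rightarrow> 'v \<Rightarrow> real"
  assumes procedure: "black_box_procedure G \<tau> f M out"
    and "\<tau> > 0"
    and arcs: "\<And>i j. (i, j) \<in> parcs G \<Longrightarrow> j \<in> pverts G"
    and V: "\<And>m. subspace (V m)" "\<And>m. V m \<subseteq> V (Suc m)"
    and closed: "\<And>m i x. i \<in> pverts G \<Longrightarrow> i \<noteq> owner m \<Longrightarrow> x \<in> V m \<Longrightarrow>
      gradient (f i) x \<in> V m \<and> gradient (fenchel_conjugate (f i)) x \<in> V m"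
    and owner: "\<And>m. owner (Suc m) \<noteq> owner m"
    and lipschitz: "\<And>m i j. (i, j) \<in> parcs G \<Longrightarrow> p m i \<le> p m j + 1"
    and source: "\<And>m. p m (owner m) \<le> 0"
    and far: "\<And>m. p m (owner (Suc m)) \<ge> \<Delta>"
    and "i \<in> pverts G" and "t < 1 + real m * (1 + \<Delta> * \<tau>) + \<tau> * p m i"
  shows "M i t \<subseteq> V m"
proof -
  have memory: "t < 0 \<Longrightarrow> M i t = {}" "M i 0 = {0}"
    "t > 0 \<Longrightarrow> M i t \<subseteq> comp_memory (f i) (M i) t \<union> comm_memory G \<tau> M i t"
    if "i \<in> pverts G" for i t
    using procedure that by (simp_all add: black_box_procedure_def)
  \<comment> \<open>Memories at real times refer to times earlier by \<open>1\<close> or \<open>\<tau>\<close>, so the induction counts steps of length \<open>min 1 \<tau>\<close>.\<close>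
  have induction: "M i t \<subseteq> V m"
    if "t < real N * min 1 \<tau>" "i \<in> pverts G" "t < 1 + real m * (1 + \<Delta> * \<tau>) + \<tau> * p m i"
    for N i t m
    using that
  proof (induction N arbitrary: i t m)
    case 0
    then show ?case
      using memory(1)[of i t] by simp
  next
    case (Suc N)
    have earlier: "t - 1 < real N * min 1 \<tau>" "t - \<tau> < real N * min 1 \<tau>"
      using Suc.prems(1) by (auto simp: algebra_simps)
    consider "t < 0" | "t = 0" | "t > 0"
      by linarith
    then show ?case
    proof cases
      case 1
      then show ?thesis
        using memory(1) Suc.prems(2) by simp
    next
      case 2
      then show ?thesis
        using memory(2) Suc.prems(2) subspace_0[OF V(1)] by simp
    next
      case 3
      have comm: "comm_memory G \<tau> M i t \<subseteq> V m"
        unfolding comm_memory_def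
      proof (intro span_minimal V UN_least)
        fix j assume "j \<in> {j. (i, j) \<in> parcs G}"
        then have j: "(i, j) \<in> parcs G" by simp
        have "\<tau> * p m i \<le> \<tau> * (p m j + 1)"
          using lipschitz[OF j] \<open>\<tau> > 0\<close> by (intro mult_left_mono) auto
        then show "M j (t - \<tau>) \<subseteq> V m"
          using Suc.prems(3) by (intro Suc.IH earlier arcs[OF j]) (simp add: algebra_simps)
      qed
      have comp: "comp_memory (f i) (M i) t \<subseteq> V m"
      proof (cases "i = owner m")
        case False
        have "M i (t - 1) \<subseteq> V m"
          using Suc.prems by (intro Suc.IH earlier) auto
        then show ?thesis
          unfolding comp_memory_def using closed[OF Suc.prems(2) False]
          by (intro span_minimal V) auto
      next
        case True
        then have "\<tau> * p m i \<le> 0"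
          using source[of m] \<open>\<tau> > 0\<close> by (simp add: mult_le_0_iff)
        \<comment> \<open>One time unit earlier the owner itself was still confined to the previous subspace, which its
          computations preserve; for \<open>m = 0\<close> that was before time \<open>0\<close>, when memories are empty.\<close>
        then have t: "t - 1 < real m * (1 + \<Delta> * \<tau>)"
          using Suc.prems(3) by simp
        show ?thesis
        proof (cases m)
          case 0
          then have "M i (t - 1) = {}"
            using t memory(1)[OF Suc.prems(2)] by simp
          then show ?thesis
            using subspace_0[OF V(1)] by (simp add: comp_memory_def)
        next
          case (Suc k)
          then have i: "i = owner (Suc k)" "i \<noteq> owner k"
            using True owner by auto
          have "\<tau> * \<Delta> \<le> \<tau> * p k i"
            using far[of k] i \<open>\<tau> > 0\<close> by (intro mult_left_mono) auto
          then have "M i (t - 1) \<subseteq> V k"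
            using t Suc Suc.prems(2) by (intro Suc.IH earlier) (auto simp: algebra_simps)
          then have "comp_memory (f i) (M i) t \<subseteq> V k"
            unfolding comp_memory_def using closed[OF Suc.prems(2) i(2)]
            by (intro span_minimal V) auto
          then show ?thesis
            using V(2)[of k] Suc by auto
        qed
      qed
      show ?thesis
        using comm comp memory(3)[OF Suc.prems(2) 3] by blast
    qed
  qed
  obtain N :: nat where "t / min 1 \<tau> < real N"
    using reals_Archimedean2 by blast
  then have "t < real N * min 1 \<tau>"
    using \<open>\<tau> > 0\<close> by (simp add: pos_divide_less_eq)
  then show ?thesis
    using assms(11,12) by (intro induction[of t N])
qed

lemma SUP_finite_attained:
  fixes F :: "'b \<Rightarrow> 'c::complete_linorder"
  assumes "finite A" "A \<noteq> {}"
  obtains a where "a \<in> A" "(SUP a\<in>A. F a) = F a"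
proof -
  have "Sup (F ` A) \<in> F ` A"
    using assms Max_in[of "F ` A"] by (simp add: Max_Sup)
  then show thesis
    using that by auto
qed

text \<open>
  The vertex set is finite, so the diameter is the distance of some pair \<open>(u, v)\<close>. The function \<open>h\<close> is the
  distance from \<open>u\<close>. Because arcs can be reversed it changes by at most \<open>1\<close> along each arc in either
  direction, so \<open>\<Delta> - h\<close> can serve as a potential that vanishes at \<open>v\<close>.
\<close>
lemma diameter_attained:
  fixes G :: "'v pair_pre_digraph"
  assumes "pair_graph G" "pverts G \<noteq> {}" "graph_diameter G = ereal \<Delta>"
  obtains u v and h :: "'v \<Rightarrow> real" where
    "u \<in> pverts G" "v \<in> pverts G" "h u = 0" "h v = \<Delta>"
    "\<And>i. i \<in> pverts G \<Longrightarrow> 0 \<le> h i \<and> h i \<le> \<Delta>"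
    "\<And>i j. (i, j) \<in> parcs G \<Longrightarrow> \<bar>h i - h j\<bar> \<le> 1"
proof -
  interpret pair_graph G by fact
  let ?\<mu> = "wf_digraph.\<mu> (with_proj G) (\<lambda>_. 1)"
  obtain u where u: "u \<in> pverts G" "graph_diameter G = (SUP v\<in>pverts G. ?\<mu> u v)"
    unfolding graph_diameter_def
    by (rule SUP_finite_attained[OF pair_finite_verts assms(2), where F = "\<lambda>u. SUP v\<in>pverts G. ?\<mu> u v"])
  obtain v where v: "v \<in> pverts G" "graph_diameter G = ?\<mu> u v"
    unfolding u(2) by (rule SUP_finite_attained[OF pair_finite_verts assms(2), where F = "?\<mu> u"])
  have nonneg: "?\<mu> u i \<ge> 0" for i
    unfolding \<mu>_def by (intro INF_greatest) (auto intro!: pos_cost_pos_awalk_cost)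
  have le: "?\<mu> u i \<le> ereal \<Delta>" if "i \<in> pverts G" for i
    unfolding assms(3)[symmetric] u(2) using that by (rule SUP_upper)
  have "?\<mu> u u \<le> 0"
    using min_cost_le_walk_cost[of u "[]" u "\<lambda>_. 1"] u(1) by (simp add: awalk_Nil_iff zero_ereal_def)
  define h where "h i = real_of_ereal (?\<mu> u i)" for i
  have h: "?\<mu> u i = ereal (h i)" if "i \<in> pverts G" for i
    unfolding h_def using nonneg[of i] le[OF that] by (intro ereal_real'[symmetric]) auto
  have step: "h j \<le> h i + 1" if "(i, j) \<in> parcs G" for i j
  proof -
    have "?\<mu> u j \<le> ?\<mu> u i + ereal 1"
      using that by (intro pos_cost_mu_triangle[of _ "(i, j)"]) (auto simp: arc_to_ends_def)
    moreover have "i \<in> pverts G" "j \<in> pverts G"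
      using that arc_fst_in_verts arc_snd_in_verts by force+
    ultimately show ?thesis
      by (simp add: h)
  qed
  show thesis
  proof
    show "u \<in> pverts G" "v \<in> pverts G" by fact+
    show "h u = 0"
      using \<open>?\<mu> u u \<le> 0\<close> nonneg[of u] by (simp add: h_def)
    show "h v = \<Delta>"
      using v(2) assms(3) h[OF v(1)] by simp
    show "0 \<le> h i \<and> h i \<le> \<Delta>" if "i \<in> pverts G" for i
      using nonneg[of i] le[of i] h[of i] that by simp
    show "\<bar>h i - h j\<bar> \<le> 1" if "(i, j) \<in> parcs G" for i j
    proof -
      have "(j, i) \<in> parcs G"
        using that pair_sym_arcs by (auto simp: symmetric_def elim: symE)
      then show ?thesis
        using step[OF that] step[of j i] by simp
    qed
  qed
qed

section \<open>The chain operator and its geometric solution\<close>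

definition swap_even :: "nat \<Rightarrow> nat"
  where "swap_even k = (if even k then k + 1 else k - 1)"

definition swap_odd :: "nat \<Rightarrow> nat"
  where "swap_odd k = (if k = 0 then 0 else if odd k then k + 1 else k - 1)"

lemma swap_even_swap_even: "swap_even (swap_even k) = k"
  by (auto simp: swap_even_def elim: oddE)

lemma swap_odd_swap_odd: "swap_odd (swap_odd k) = k"
  by (auto simp: swap_odd_def elim: evenE)

lemmas reflection_swap_even = reflection_permute[OF swap_even_swap_even]
  and reflection_swap_odd = reflection_permute[OF swap_odd_swap_odd]

text \<open>
  For even \<open>m\<close> no pair \<open>{2j, 2j + 1}\<close> straddles the boundary between \<open>{..<m}\<close> and \<open>{m..}\<close>. The
  pairs \<open>{2j + 1, 2j + 2}\<close> behave in the same way for odd \<open>m\<close>.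
\<close>
lemma permute_swap_even_vanishing_from:
  assumes "even m" "x \<in> vanishing_from m"
  shows "permute swap_even x \<in> vanishing_from m"
proof -
  have "swap_even k \<ge> m" if "k \<ge> m" for k
    using that assms(1) by (cases "k = m") (auto simp: swap_even_def)
  then show ?thesis
    using assms(2) by (simp add: vanishing_from_def nth_permute swap_even_swap_even)
qed

lemma permute_swap_odd_vanishing_from:
  assumes "odd m" "x \<in> vanishing_from m"
  shows "permute swap_odd x \<in> vanishing_from m"
proof -
  have "swap_odd k \<ge> m" if "k \<ge> m" for k
    using that assms(1) by (cases "k = m") (auto simp: swap_odd_def elim: oddE)
  then show ?thesis
    using assms(2) by (simp add: vanishing_from_def nth_permute swap_odd_swap_odd)
qed

text \<open>
  Up to the factor \<open>\<gamma>\<close> and the shift \<open>\<alpha>\<close> this is the path Laplacian on the natural numbers, since the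
  two permutations together join each number to its neighbours.
\<close>
definition chain :: "real \<Rightarrow> real \<Rightarrow> ell2 \<Rightarrow> ell2"
  where "chain \<alpha> \<gamma> x = coupling \<alpha> \<gamma> (permute swap_odd) x + coupling 0 \<gamma> (permute swap_even) x"

lemma self_adjoint_chain: "self_adjoint (chain \<alpha> \<gamma>)"
proof -
  interpret odd_part: self_adjoint "coupling \<alpha> \<gamma> (permute swap_odd)"
    by (rule reflection.self_adjoint_coupling[OF reflection_swap_odd])
  interpret even_part: self_adjoint "coupling 0 \<gamma> (permute swap_even)"
    by (rule reflection.self_adjoint_coupling[OF reflection_swap_even])
  show ?thesis
    unfolding chain_def[abs_def]
    by (intro self_adjoint.intro bounded_linear_add odd_part.bounded_linear_axioms
        even_part.bounded_linear_axioms self_adjoint_axioms.intro)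
       (simp add: inner_add_left inner_add_right odd_part.adjoint even_part.adjoint)
qed

lemma inner_chain: "\<gamma> \<ge> 0 \<Longrightarrow> inner x (chain \<alpha> \<gamma> x) \<ge> \<alpha> * (norm x)\<^sup>2"
  using reflection.inner_coupling[OF reflection_swap_odd, of \<gamma> \<alpha> x]
    reflection.inner_coupling[OF reflection_swap_even, of \<gamma> 0 x]
  by (simp add: chain_def inner_add_right)

lemma norm_chain:
  assumes "\<alpha> \<ge> 0" "\<gamma> \<ge> 0"
  shows "norm (chain \<alpha> \<gamma> x) \<le> (\<alpha> + 4 * \<gamma>) * norm x"
proof -
  have "norm (chain \<alpha> \<gamma> x) \<le> (\<alpha> + 2 * \<gamma>) * norm x + (0 + 2 * \<gamma>) * norm x"
    unfolding chain_def
    by (intro norm_triangle_mono reflection.norm_coupling[OF reflection_swap_odd]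
        reflection.norm_coupling[OF reflection_swap_even] assms order_refl)
  then show ?thesis
    by (simp add: algebra_simps)
qed

text \<open>
  Away from coordinate \<open>0\<close> the equation \<open>chain \<alpha> \<gamma> x = 0\<close> is the recurrence
  \<open>\<alpha> x\<^sub>k = \<gamma> (x\<^sub>k\<^sub>-\<^sub>1 - 2 x\<^sub>k + x\<^sub>k\<^sub>+\<^sub>1)\<close>. The powers of \<open>q\<close> solve it exactly when
  \<open>\<alpha> q = \<gamma> (1 - q)\<^sup>2\<close>. At coordinate \<open>0\<close> there is only one neighbour, and the value left over there is
  the right-hand side.
\<close>
lemma chain_geometric:
  assumes "\<bar>q\<bar> < 1" "\<alpha> * q = \<gamma> * (1 - q)\<^sup>2"
  shows "chain \<alpha> \<gamma> (geometric q) = (\<alpha> + \<gamma> * (1 - q)) *\<^sub>R first_unit"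
proof -
  have nth: "ell2_nth (chain \<alpha> \<gamma> (geometric q)) k = \<alpha> * q ^ k
      + \<gamma> * (q ^ k - q ^ swap_odd k) + \<gamma> * (q ^ k - q ^ swap_even k)" for k
    using assms(1) by (simp add: chain_def coupling_def plus_ell2.rep_eq minus_ell2.rep_eq
        scaleR_ell2.rep_eq nth_permute swap_odd_swap_odd swap_even_swap_even geometric.rep_eq)
  have "ell2_nth (chain \<alpha> \<gamma> (geometric q)) k = ell2_nth ((\<alpha> + \<gamma> * (1 - q)) *\<^sub>R first_unit) k" for k
  proof (cases k)
    case 0
    then show ?thesis
      by (simp add: nth scaleR_ell2.rep_eq first_unit.rep_eq swap_odd_def swap_even_def)
  next
    case (Suc j)
    then have "ell2_nth (chain \<alpha> \<gamma> (geometric q)) k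
        = \<alpha> * q ^ (j + 1) + \<gamma> * (2 * q ^ (j + 1) - q ^ j - q ^ (j + 2))"
      unfolding nth by (cases "even k") (simp_all add: swap_odd_def swap_even_def algebra_simps)
    also have "\<dots> = q ^ j * (\<alpha> * q - \<gamma> * (1 - q)\<^sup>2)"
      by (simp add: power2_eq_square algebra_simps)
    finally show ?thesis
      using assms(2) Suc by (simp add: scaleR_ell2.rep_eq first_unit.rep_eq)
  qed
  then show ?thesis
    by (simp add: ell2_eq_iff)
qed

lemma sum_coupling:
  assumes "finite I" "u \<in> I" "v \<in> I" "u \<noteq> v"
  shows "(\<Sum>i\<in>I. coupling \<alpha> (if i = u \<or> i = v then c else 0) (permute (if i = u then swap_odd else swap_even)) x)
    = chain (real (card I) * \<alpha>) c x"
proof -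
  have "coupling \<alpha> (if i = u \<or> i = v then c else 0) (permute (if i = u then swap_odd else swap_even)) x
      = \<alpha> *\<^sub>R x + (if i = u then c *\<^sub>R (x - permute swap_odd x) else 0)
        + (if i = v then c *\<^sub>R (x - permute swap_even x) else 0)" for i
    using assms(4) by (simp add: coupling_def)
  then show ?thesis
    using assms by (simp add: sum.distrib chain_def coupling_def scaleR_sum_left sum_constant_scaleR)
qed

lemma scaleR_chain: "a *\<^sub>R chain \<alpha> \<gamma> x = chain (a * \<alpha>) (a * \<gamma>) x"
  by (simp add: chain_def coupling_def scaleR_add_right)

text \<open>
  For \<open>s = \<surd>(\<beta> / \<alpha>)\<close> and \<open>\<gamma> = (\<beta> - \<alpha>) / 4\<close> the last equation says that \<open>\<alpha> q = \<gamma> (1 - q)\<^sup>2\<close>.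
\<close>
lemma contraction_ratio:
  fixes s :: real
  assumes "s \<ge> 1"
  defines "q \<equiv> (s - 1) / (s + 1)"
  shows "0 \<le> q" "q < 1" "q\<^sup>2 \<ge> 1 - 4 / s" "4 * q = (s\<^sup>2 - 1) * (1 - q)\<^sup>2"
proof -
  show "0 \<le> q" "q < 1"
    using assms by (simp_all add: q_def)
  have q: "1 - q = 2 / (s + 1)"
    using assms by (simp add: q_def field_simps)
  have "q\<^sup>2 = 1 - 2 * (1 - q) + (1 - q)\<^sup>2"
    by (simp add: power2_eq_square algebra_simps)
  then have "q\<^sup>2 \<ge> 1 - 2 * (1 - q)"
    by simp
  moreover have "2 * (1 - q) \<le> 4 / s"
    unfolding q using assms by (simp add: field_simps)
  ultimately show "q\<^sup>2 \<ge> 1 - 4 / s"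
    by linarith
  show "4 * q = (s\<^sup>2 - 1) * (1 - q)\<^sup>2"
    unfolding q using assms by (simp add: q_def power2_eq_square divide_simps) (simp add: algebra_simps)
qed


section \<open>The lower bound\<close>

lemma powr_le_power:
  fixes r :: real
  assumes "0 \<le> r" "r \<le> 1" "real m \<le> y"
  shows "r powr y \<le> r ^ m"
proof (cases "r = 0")
  case False
  then have "r powr y \<le> r powr real m"
    using assms by (intro powr_mono') auto
  then show ?thesis
    using assms False by (simp add: powr_realpow)
qed simp

theorem theorem1:
  fixes \<tau> \<Delta> \<alpha>\<^sub>g \<beta>\<^sub>g :: real and G :: "nat pair_pre_digraph" and n :: nat
  assumes "\<tau> > 0"
    and "n > 0" and "pair_graph G" and "pverts G = {1..n}"
    and "Digraph_Component.connected (with_proj G)"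
    and "graph_diameter G = ereal \<Delta>" and "\<Delta> > 0"
    and "\<alpha>\<^sub>g > 0" and "\<beta>\<^sub>g \<ge> \<alpha>\<^sub>g"
  shows "\<exists>(f :: nat \<Rightarrow> ell2 \<Rightarrow> real) \<theta>opt.
    (\<forall>i\<in>{1..n}. (\<exists>\<alpha>>0. strongly_convex \<alpha> (f i)) \<and> (\<exists>\<beta>. smooth \<beta> (f i))) \<and>
    strongly_convex \<alpha>\<^sub>g (average n f) \<and> smooth \<beta>\<^sub>g (average n f) \<and>
    (\<forall>\<theta>. is_arg_min (average n f) (\<lambda>_. True) \<theta> \<longleftrightarrow> \<theta> = \<theta>opt) \<and>
    (\<forall>t\<ge>0. \<forall>M out. black_box_procedure G \<tau> f M out \<longrightarrow>
      (\<forall>i\<in>{1..n}.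
        average n f (out i t) - average n f \<theta>opt \<ge>
          \<alpha>\<^sub>g / 2 * max 0 (1 - 4 / sqrt (\<beta>\<^sub>g / \<alpha>\<^sub>g)) powr (1 + t / (1 + \<Delta> * \<tau>))
            * (norm (out i 0 - \<theta>opt))\<^sup>2))"
proof -
  define s where "s = sqrt (\<beta>\<^sub>g / \<alpha>\<^sub>g)"
  define q where "q = (s - 1) / (s + 1)"
  \<comment> \<open>The chain operator has norm at most \<open>\<alpha>\<^sub>g + 4 * \<gamma>\<close>, which has to be \<open>\<beta>\<^sub>g\<close>.\<close>
  define \<gamma> where "\<gamma> = (\<beta>\<^sub>g - \<alpha>\<^sub>g) / 4"
  have "s \<ge> 1" and s2: "\<beta>\<^sub>g = \<alpha>\<^sub>g * s\<^sup>2"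
    using assms(8,9) by (simp_all add: s_def)
  note q = contraction_ratio[OF \<open>s \<ge> 1\<close>, folded q_def]
  have \<gamma>: "\<gamma> \<ge> 0" "\<alpha>\<^sub>g + 4 * \<gamma> = \<beta>\<^sub>g"
    using assms(9) by (simp_all add: \<gamma>_def field_simps)
  have fixed: "\<alpha>\<^sub>g * q = \<gamma> * (1 - q)\<^sup>2"
  proof -
    have "4 * \<gamma> = \<alpha>\<^sub>g * (s\<^sup>2 - 1)"
      by (simp add: \<gamma>_def s2 right_diff_distrib)
    then have "4 * (\<alpha>\<^sub>g * q) = 4 * (\<gamma> * (1 - q)\<^sup>2)"
      using arg_cong[OF q(4), of "(*) \<alpha>\<^sub>g"] by (simp flip: mult.assoc)
    then show ?thesis by simp
  qed
  obtain u v and h :: "nat \<Rightarrow> real" where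
    uv: "u \<in> {1..n}" "v \<in> {1..n}" "h u = 0" "h v = \<Delta>"
    and h: "\<And>i. i \<in> {1..n} \<Longrightarrow> 0 \<le> h i \<and> h i \<le> \<Delta>"
    and step: "\<And>i j. (i, j) \<in> parcs G \<Longrightarrow> \<bar>h i - h j\<bar> \<le> 1"
    using diameter_attained[OF assms(3) _ assms(6)] assms(2,4)
    by (metis atLeastAtMost_iff empty_iff less_eq_Suc_le One_nat_def order_refl)
  have "u \<noteq> v"
    using uv assms(7) by auto
  \<comment> \<open>The factors \<open>n\<close> cancel the averaging over the nodes.\<close>
  define c where "c i = (if i = u \<or> i = v then real n * \<gamma> else 0)" for i
  define \<sigma> where "\<sigma> i = (if i = u then swap_odd else swap_even)" for i
  define e where "e = (\<alpha>\<^sub>g + \<gamma> * (1 - q)) *\<^sub>R first_unit"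
  define b where "b i = (if i = u then real n *\<^sub>R e else 0)" for i
  define f where "f i = quadratic (coupling \<alpha>\<^sub>g (c i) (permute (\<sigma> i))) (b i)" for i
  have c: "c i \<ge> 0" for i
    using \<gamma> by (simp add: c_def)
  have reflection: "reflection (permute (\<sigma> i))" for i
    by (simp add: \<sigma>_def reflection_swap_even reflection_swap_odd)
  interpret chain: self_adjoint "chain \<alpha>\<^sub>g \<gamma>"
    by (rule self_adjoint_chain)

  have local_convex: "strongly_convex \<alpha>\<^sub>g (f i)" for i
    unfolding f_def
    by (intro self_adjoint.strongly_convex_quadratic reflection.self_adjoint_coupling
        reflection.inner_coupling reflection c)
  have local_smooth: "smooth (\<alpha>\<^sub>g + 2 * c i) (f i)" for i
    unfolding f_def using assms(8) c[of i]
    by (intro self_adjoint.smooth_quadratic reflection.self_adjoint_coupling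
        reflection.norm_coupling reflection) auto

  have average: "average n f = quadratic (chain \<alpha>\<^sub>g \<gamma>) e"
  proof -
    have "(1 / real n) *\<^sub>R (\<Sum>i=1..n. coupling \<alpha>\<^sub>g (c i) (permute (\<sigma> i)) x) = chain \<alpha>\<^sub>g \<gamma> x" for x
      unfolding c_def \<sigma>_def
      using sum_coupling[of "{1..n}" u v \<alpha>\<^sub>g "real n * \<gamma>" x] uv(1,2) \<open>u \<noteq> v\<close> assms(2)
      by (simp add: scaleR_chain)
    moreover have "(1 / real n) *\<^sub>R (\<Sum>i=1..n. b i) = e"
      using uv(1) assms(2) by (simp add: b_def)
    ultimately show ?thesis
      unfolding f_def average_quadratic by simp
  qed
  have optimum: "chain \<alpha>\<^sub>g \<gamma> (geometric q) = e"
    unfolding e_def using q(1,2) fixed by (intro chain_geometric) auto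
  have lower: "inner x (chain \<alpha>\<^sub>g \<gamma> x) \<ge> \<alpha>\<^sub>g * (norm x)\<^sup>2" for x
    using \<gamma>(1) by (rule inner_chain)

  have bound: "average n f (out i t) - average n f (geometric q) \<ge>
          \<alpha>\<^sub>g / 2 * max 0 (1 - 4 / s) powr (1 + t / (1 + \<Delta> * \<tau>)) * (norm (out i 0 - geometric q))\<^sup>2"
    if "t \<ge> 0" and procedure: "black_box_procedure G \<tau> f M out" and i: "i \<in> {1..n}" for t M out i
  proof -
    define D where "D = 1 + \<Delta> * \<tau>"
    \<comment> \<open>Coordinate \<open>m\<close> cannot appear before time \<open>m * D + 1\<close>; this is the least \<open>m\<close> for which that is
      still to come at time \<open>t\<close>.\<close>
    define m where "m = nat \<lfloor>(t + \<Delta> * \<tau>) / D\<rfloor>"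
    have D: "D \<ge> 1" "t + \<Delta> * \<tau> \<ge> 0"
      using assms(1,7) \<open>t \<ge> 0\<close> by (simp_all add: D_def)
    have "(t + \<Delta> * \<tau>) / D \<ge> 0"
      using D by simp
    then have m: "real m \<le> (t + \<Delta> * \<tau>) / D" "(t + \<Delta> * \<tau>) / D < real m + 1"
      unfolding m_def by linarith+
    note m(1)
    also have "(t + \<Delta> * \<tau>) / D \<le> (t + D) / D"
      using D by (intro divide_right_mono) (simp_all add: D_def)
    also have "\<dots> = 1 + t / D"
      using D by (simp add: add_divide_distrib)
    finally have exponent: "real m \<le> 1 + t / D" .
    have "t + \<Delta> * \<tau> < (real m + 1) * D"
      using m(2) D by (simp add: pos_divide_less_eq)
    then have time: "t < 1 + real m * (1 + \<Delta> * \<tau>)"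
      by (simp add: D_def algebra_simps)

    \<comment> \<open>Distance from \<open>u\<close> for even \<open>m\<close>; for odd \<open>m\<close> a lower bound of the distance from \<open>v\<close>.\<close>
    define p where "p m i = (if even m then h i else \<Delta> - h i)" for m :: nat and i
    define owner where "owner m = (if even m then u else v)" for m :: nat
    have "M i t \<subseteq> vanishing_from m"
    proof (rule memory_confined[OF procedure assms(1), where p = p and owner = owner and \<Delta> = \<Delta>])
      show "j \<in> pverts G" if "(i, j) \<in> parcs G" for i j
      proof -
        interpret pair_graph G by fact
        show ?thesis using arc_snd_in_verts[OF that] by simp
      qed
      show "subspace (vanishing_from m)" for m
        by (rule subspace_vanishing_from)
      show "vanishing_from m \<subseteq> vanishing_from (Suc m)" for m
        by (auto simp: vanishing_from_def)
      show "owner (Suc m) \<noteq> owner m" for m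
        using \<open>u \<noteq> v\<close> by (simp add: owner_def)
      show "p m i \<le> p m j + 1" if "(i, j) \<in> parcs G" for m i j
        using step[OF that] by (auto simp: p_def)
      show "p m (owner m) \<le> 0" "p m (owner (Suc m)) \<ge> \<Delta>" for m
        using uv by (simp_all add: p_def owner_def)
      show "i \<in> pverts G"
        using i assms(4) by simp
      have "\<tau> * p m i \<ge> 0"
        using h[OF i] assms(1) by (simp add: p_def)
      then show "t < 1 + real m * (1 + \<Delta> * \<tau>) + \<tau> * p m i"
        using time by linarith
      show "gradient (f i) x \<in> vanishing_from m \<and>
          gradient (fenchel_conjugate (f i)) x \<in> vanishing_from m"
        if "i \<noteq> owner m" "x \<in> vanishing_from m" for m i x
      proof -
        \<comment> \<open>The linear term sits at \<open>u\<close>, which owns every even \<open>m\<close>. So \<open>m\<close> is odd if \<open>b i \<noteq> 0\<close>.\<close>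
        have "b i \<in> vanishing_from m"
          using that(1) subspace_0[OF subspace_vanishing_from]
          by (auto simp: b_def owner_def e_def vanishing_from_def scaleR_ell2.rep_eq first_unit.rep_eq
              split: if_splits)
        moreover have "permute (\<sigma> i) y \<in> vanishing_from m" if "c i \<noteq> 0" "y \<in> vanishing_from m" for y
          using that \<open>i \<noteq> owner m\<close> \<open>u \<noteq> v\<close>
          by (auto simp: c_def \<sigma>_def owner_def split: if_splits
              intro: permute_swap_even_vanishing_from permute_swap_odd_vanishing_from)
        ultimately show ?thesis
          unfolding f_def using that(2) assms(8) c subspace_vanishing_from reflection
          by (intro conjI reflection.gradients_coupling_in_subspace) auto
      qed
    qed
    moreover have "\<forall>t\<ge>0. out i t \<in> M i t" "M i 0 = {0}"
      using procedure i assms(4) by (simp_all add: black_box_procedure_def)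
    ultimately have out: "out i t \<in> vanishing_from m" "out i 0 = 0"
      using \<open>t \<ge> 0\<close> by auto

    define r where "r = max 0 (1 - 4 / s)"
    have r: "0 \<le> r" "r \<le> 1" "r \<le> q\<^sup>2"
      using q(3) \<open>s \<ge> 1\<close> by (simp_all add: r_def)
    have "r powr (1 + t / D) \<le> r ^ m"
      using r exponent by (intro powr_le_power)
    also have "\<dots> \<le> (q\<^sup>2) ^ m"
      using r by (intro power_mono)
    finally have "r powr (1 + t / D) * (norm (geometric q))\<^sup>2 \<le> (q\<^sup>2) ^ m * (norm (geometric q))\<^sup>2"
      by (intro mult_right_mono) auto
    also have "\<dots> \<le> (norm (out i t - geometric q))\<^sup>2"
      using out(1) q(1,2) by (intro dist_geometric) auto
    finally have "\<alpha>\<^sub>g / 2 * (r powr (1 + t / D) * (norm (geometric q))\<^sup>2)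
        \<le> \<alpha>\<^sub>g / 2 * (norm (out i t - geometric q))\<^sup>2"
      using assms(8) by (intro mult_left_mono) auto
    also have "\<dots> \<le> average n f (out i t) - average n f (geometric q)"
      unfolding average by (rule chain.quadratic_gap[OF lower optimum])
    finally show ?thesis
      using out(2) by (simp add: r_def D_def mult.assoc)
  qed

  show ?thesis
  proof (intro exI[of _ f] exI[of _ "geometric q"] conjI ballI allI impI)
    show "\<exists>\<alpha>>0. strongly_convex \<alpha> (f i)" for i
      using local_convex assms(8) by blast
    show "\<exists>\<beta>. smooth \<beta> (f i)" for i
      using local_smooth by blast
    show "strongly_convex \<alpha>\<^sub>g (average n f)"
      unfolding average using lower by (rule chain.strongly_convex_quadratic)
    show "smooth \<beta>\<^sub>g (average n f)"
      unfolding average using norm_chain[of \<alpha>\<^sub>g \<gamma>] \<gamma> assms(8,9)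
      by (intro chain.smooth_quadratic) auto
    show "is_arg_min (average n f) (\<lambda>_. True) \<theta> \<longleftrightarrow> \<theta> = geometric q" for \<theta>
      unfolding average using lower assms(8) optimum by (rule chain.is_arg_min_quadratic)
  qed (use bound in \<open>simp add: s_def\<close>)
qed

end
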